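(* Let $A\subseteq\mathrm{Ag}$ and let $\mathsf{L}_1,\mathsf{L}_2$ be logics with fixed-point operators such that $\mathsf{L}_1(\alpha)=\mathsf{L}_2(\alpha)\cup\{4\}$ for $\alpha\in A$ and $\mathsf{L}_1(\alpha)=\mathsf{L}_2(\alpha)$ otherwise, and such that each $\mathsf{L}_2(\alpha)$ is contained in $\{D,T,B\}$. Then a formula $\varphi$ is $\mathsf{L}_1$-satisfiable if and only if $\mathrm{tr}^4_A(\varphi)$ is $\mathsf{L}_2$-satisfiable, where $\mathrm{tr}^4_A$ commutes with all other operations, and for $\alpha\in A$: $\mathrm{tr}^4_A([\alpha]\psi)=\mathsf{Inv}^\alpha([\alpha]\mathrm{tr}^4_A(\psi))$ and $\mathrm{tr}^4_A(\langle\alpha\rangle\psi)=\mathsf{Eve}^\alpha(\langle\alpha\rangle\mathrm{tr}^4_A(\psi))$.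
   Context: Formulas: $\varphi ::= p \mid \neg p \mid \mathtt{tt} \mid \mathtt{ff} \mid X \mid \varphi\wedge\varphi \mid \varphi\vee\varphi \mid \langle\alpha\rangle\varphi \mid [\alpha]\varphi \mid \mu X.\varphi \mid \nu X.\varphi$ over a finite agent set $\mathrm{Ag}$ and finitely many propositional variables; closed formulas only; interpreted on Kripke models $(W,R,V)$, $R\subseteq W\times\mathrm{Ag}\times W$, with the semantics of the multi-agent modal $\mu$-calculus. Frame conditions on $R_\alpha$: $D$ serial, $T$ reflexive, $B$ symmetric, $4$ transitive. A logic $\mathsf{L}$ assigns to each agent a set $\mathsf{L}(\alpha)$ of conditions; $\mathsf{L}$-models are Kripke models where each $R_\alpha$ satisfies $\mathsf{L}(\alpha)$; $\varphi$ is $\mathsf{L}$-satisfiable if true at some state of some $\mathsf{L}$-model. For a formula $\chi$ and agent $\alpha$ (with $X$ a fresh fixed-point variable): $\mathsf{Inv}^\alpha(\chi)=\nu X.(\chi\wedge[\alpha]X)$ and $\mathsf{Eve}^\alpha(\chi)=\mu X.(\chi\vee\langle\alpha\rangle X)$. *)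

theory Defs
  imports Main
begin

datatype ('ag, 'p) fm =
    Prop 'p
  | NProp 'p
  | TT
  | FF
  | Var nat
  | And "('ag, 'p) fm" "('ag, 'p) fm"
  | Or "('ag, 'p) fm" "('ag, 'p) fm"
  | Dia 'ag "('ag, 'p) fm"
  | Box 'ag "('ag, 'p) fm"
  | Mu nat "('ag, 'p) fm"
  | Nu nat "('ag, 'p) fm"

primrec fv :: "('ag, 'p) fm \<Rightarrow> nat set" where
  "fv (Prop p) = {}"
| "fv (NProp p) = {}"
| "fv TT = {}"
| "fv FF = {}"
| "fv (Var X) = {X}"
| "fv (And \<phi> \<psi>) = fv \<phi> \<union> fv \<psi>"
| "fv (Or \<phi> \<psi>) = fv \<phi> \<union> fv \<psi>"
| "fv (Dia \<alpha> \<phi>) = fv \<phi>"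
| "fv (Box \<alpha> \<phi>) = fv \<phi>"
| "fv (Mu X \<phi>) = fv \<phi> - {X}"
| "fv (Nu X \<phi>) = fv \<phi> - {X}"

text \<open>All fixed-point variables occurring in a formula: free, bound or binding.\<close>

primrec vars :: "('ag, 'p) fm \<Rightarrow> nat set" where
  "vars (Prop p) = {}"
| "vars (NProp p) = {}"
| "vars TT = {}"
| "vars FF = {}"
| "vars (Var X) = {X}"
| "vars (And \<phi> \<psi>) = vars \<phi> \<union> vars \<psi>"
| "vars (Or \<phi> \<psi>) = vars \<phi> \<union> vars \<psi>"
| "vars (Dia \<alpha> \<phi>) = vars \<phi>"
| "vars (Box \<alpha> \<phi>) = vars \<phi>"
| "vars (Mu X \<phi>) = insert X (vars \<phi>)"
| "vars (Nu X \<phi>) = insert X (vars \<phi>)"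

definition closed_fm :: "('ag, 'p) fm \<Rightarrow> bool" where
  "closed_fm \<phi> \<longleftrightarrow> fv \<phi> = {}"

record ('w, 'ag, 'p) kripke =
  worlds :: "'w set"
  acc :: "('w \<times> 'ag \<times> 'w) set"
  val :: "'w \<Rightarrow> 'p set"

definition kripke_model :: "('w, 'ag, 'p) kripke \<Rightarrow> bool" where
  "kripke_model M \<longleftrightarrow> worlds M \<noteq> {} \<and> acc M \<subseteq> worlds M \<times> UNIV \<times> worlds M"

definition acc_of :: "('w, 'ag, 'p) kripke \<Rightarrow> 'ag \<Rightarrow> ('w \<times> 'w) set" where
  "acc_of M \<alpha> = {(u, v). (u, \<alpha>, v) \<in> acc M}"

primrec sem :: "('w, 'ag, 'p) kripke \<Rightarrow> (nat \<Rightarrow> 'w set) \<Rightarrow> ('ag, 'p) fm \<Rightarrow> 'w set" where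
  "sem M \<rho> (Prop p) = {w \<in> worlds M. p \<in> val M w}"
| "sem M \<rho> (NProp p) = {w \<in> worlds M. p \<notin> val M w}"
| "sem M \<rho> TT = worlds M"
| "sem M \<rho> FF = {}"
| "sem M \<rho> (Var X) = \<rho> X"
| "sem M \<rho> (And \<phi> \<psi>) = sem M \<rho> \<phi> \<inter> sem M \<rho> \<psi>"
| "sem M \<rho> (Or \<phi> \<psi>) = sem M \<rho> \<phi> \<union> sem M \<rho> \<psi>"
| "sem M \<rho> (Dia \<alpha> \<phi>) = {w \<in> worlds M. \<exists>v. (w, v) \<in> acc_of M \<alpha> \<and> v \<in> sem M \<rho> \<phi>}"
| "sem M \<rho> (Box \<alpha> \<phi>) = {w \<in> worlds M. \<forall>v. (w, v) \<in> acc_of M \<alpha> \<longrightarrow> v \<in> sem M \<rho> \<phi>}"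
| "sem M \<rho> (Mu X \<phi>) = \<Inter>{S. S \<subseteq> worlds M \<and> sem M (\<rho>(X := S)) \<phi> \<subseteq> S}"
| "sem M \<rho> (Nu X \<phi>) = \<Union>{S. S \<subseteq> worlds M \<and> S \<subseteq> sem M (\<rho>(X := S)) \<phi>}"

lemma sem_cong:
  "(\<And>X. X \<in> fv \<phi> \<Longrightarrow> \<rho> X = \<rho>' X) \<Longrightarrow> sem M \<rho> \<phi> = sem M \<rho>' \<phi>"
proof (induction \<phi> arbitrary: \<rho> \<rho>')
  case (And \<phi> \<psi>)
  have "sem M \<rho> \<phi> = sem M \<rho>' \<phi>" "sem M \<rho> \<psi> = sem M \<rho>' \<psi>"
    by (rule And.IH; simp add: And.prems)+
  then show ?case by simp
next
  case (Or \<phi> \<psi>)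
  have "sem M \<rho> \<phi> = sem M \<rho>' \<phi>" "sem M \<rho> \<psi> = sem M \<rho>' \<psi>"
    by (rule Or.IH; simp add: Or.prems)+
  then show ?case by simp
next
  case (Dia \<alpha> \<phi>)
  have "sem M \<rho> \<phi> = sem M \<rho>' \<phi>" by (rule Dia.IH) (simp add: Dia.prems)
  then show ?case by simp
next
  case (Box \<alpha> \<phi>)
  have "sem M \<rho> \<phi> = sem M \<rho>' \<phi>" by (rule Box.IH) (simp add: Box.prems)
  then show ?case by simp
next
  case (Mu X \<phi>)
  have "sem M (\<rho>(X := S)) \<phi> = sem M (\<rho>'(X := S)) \<phi>" for S
    by (rule Mu.IH) (simp add: Mu.prems)
  then show ?case by simp
next
  case (Nu X \<phi>)
  have "sem M (\<rho>(X := S)) \<phi> = sem M (\<rho>'(X := S)) \<phi>" for S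
    by (rule Nu.IH) (simp add: Nu.prems)
  then show ?case by simp
qed simp_all

text \<open>For closed formulas the choice of the environment is immaterial.\<close>

definition true_at :: "('w, 'ag, 'p) kripke \<Rightarrow> 'w \<Rightarrow> ('ag, 'p) fm \<Rightarrow> bool" where
  "true_at M w \<phi> \<longleftrightarrow> w \<in> sem M (\<lambda>_. {}) \<phi>"

lemma true_at_closed: "closed_fm \<phi> \<Longrightarrow> true_at M w \<phi> \<longleftrightarrow> w \<in> sem M \<rho> \<phi>"
  unfolding true_at_def closed_fm_def by (metis empty_iff sem_cong)

datatype frame_cond = CondD | CondT | CondB | Cond4

primrec satisfies_cond :: "'w set \<Rightarrow> ('w \<times> 'w) set \<Rightarrow> frame_cond \<Rightarrow> bool" where
  "satisfies_cond W r CondD \<longleftrightarrow> (\<forall>w\<in>W. \<exists>v\<in>W. (w, v) \<in> r)"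
| "satisfies_cond W r CondT \<longleftrightarrow> refl_on W r"
| "satisfies_cond W r CondB \<longleftrightarrow> sym r"
| "satisfies_cond W r Cond4 \<longleftrightarrow> trans r"

type_synonym 'ag modal_logic = "'ag \<Rightarrow> frame_cond set"

definition L_model :: "'ag modal_logic \<Rightarrow> ('w, 'ag, 'p) kripke \<Rightarrow> bool" where
  "L_model L M \<longleftrightarrow>
     kripke_model M \<and> (\<forall>\<alpha>. \<forall>c\<in>L \<alpha>. satisfies_cond (worlds M) (acc_of M \<alpha>) c)"

text \<open>
  HOL cannot quantify over types, so the type from which the worlds are drawn is a parameter;
  the worlds of a model form an arbitrary non-empty subset of that type.
\<close>

definition satisfiable :: "'w itself \<Rightarrow> 'ag modal_logic \<Rightarrow> ('ag, 'p) fm \<Rightarrow> bool" where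
  "satisfiable (_ :: 'w itself) L \<phi> \<longleftrightarrow>
     (\<exists>M :: ('w, 'ag, 'p) kripke. L_model L M \<and> (\<exists>w\<in>worlds M. true_at M w \<phi>))"

definition fresh :: "('ag, 'p) fm \<Rightarrow> nat" where
  "fresh \<chi> = (LEAST X. X \<notin> vars \<chi>)"

definition Inv :: "'ag \<Rightarrow> ('ag, 'p) fm \<Rightarrow> ('ag, 'p) fm" where
  "Inv \<alpha> \<chi> = (let X = fresh \<chi> in Nu X (And \<chi> (Box \<alpha> (Var X))))"

definition Eve :: "'ag \<Rightarrow> ('ag, 'p) fm \<Rightarrow> ('ag, 'p) fm" where
  "Eve \<alpha> \<chi> = (let X = fresh \<chi> in Mu X (Or \<chi> (Dia \<alpha> (Var X))))"

primrec tr4 :: "'ag set \<Rightarrow> ('ag, 'p) fm \<Rightarrow> ('ag, 'p) fm" where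
  "tr4 A (Prop p) = Prop p"
| "tr4 A (NProp p) = NProp p"
| "tr4 A TT = TT"
| "tr4 A FF = FF"
| "tr4 A (Var X) = Var X"
| "tr4 A (And \<phi> \<psi>) = And (tr4 A \<phi>) (tr4 A \<psi>)"
| "tr4 A (Or \<phi> \<psi>) = Or (tr4 A \<phi>) (tr4 A \<psi>)"
| "tr4 A (Dia \<alpha> \<phi>) = (if \<alpha> \<in> A then Eve \<alpha> (Dia \<alpha> (tr4 A \<phi>)) else Dia \<alpha> (tr4 A \<phi>))"
| "tr4 A (Box \<alpha> \<phi>) = (if \<alpha> \<in> A then Inv \<alpha> (Box \<alpha> (tr4 A \<phi>)) else Box \<alpha> (tr4 A \<phi>))"
| "tr4 A (Mu X \<phi>) = Mu X (tr4 A \<phi>)"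
| "tr4 A (Nu X \<phi>) = Nu X (tr4 A \<phi>)"

lemma finite_vars: "finite (vars \<phi>)"
  by (induction \<phi>) auto

lemma fv_subset_vars: "fv \<phi> \<subseteq> vars \<phi>"
  by (induction \<phi>) auto

lemma fresh_notin_vars: "fresh \<chi> \<notin> vars \<chi>"
  unfolding fresh_def by (rule LeastI_ex) (metis ex_new_if_finite finite_vars infinite_UNIV_nat)

lemma fv_Inv: "fv (Inv \<alpha> \<chi>) = fv \<chi>"
  using fresh_notin_vars[of \<chi>] fv_subset_vars[of \<chi>] by (auto simp: Inv_def Let_def)

lemma fv_Eve: "fv (Eve \<alpha> \<chi>) = fv \<chi>"
  using fresh_notin_vars[of \<chi>] fv_subset_vars[of \<chi>] by (auto simp: Eve_def Let_def)

lemma fv_tr4: "fv (tr4 A \<phi>) = fv \<phi>"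
  by (induction \<phi>) (auto simp: fv_Inv fv_Eve)

lemma closed_tr4: "closed_fm \<phi> \<Longrightarrow> closed_fm (tr4 A \<phi>)"
  by (simp add: closed_fm_def fv_tr4)

end

theory Submission
  imports Defs
begin

text \<open>
  Closing the relations of the agents in \<open>A\<close> under transitivity preserves seriality, reflexivity and
  symmetry, and the fixed points in \<open>tr4\<close> make the modalities of \<open>A\<close> range over this closure. So
  \<open>tr4 A \<phi>\<close> has in a model the value that \<open>\<phi>\<close> has in its closure; a model that is already
  transitive for the agents in \<open>A\<close> is its own closure.
\<close>

definition trans_closure_model :: "'ag set \<Rightarrow> ('w, 'ag, 'p) kripke \<Rightarrow> ('w, 'ag, 'p) kripke" where
  "trans_closure_model A M =
     M\<lparr>acc := {(u, \<alpha>, v). (u, v) \<in> (if \<alpha> \<in> A then (acc_of M \<alpha>)\<^sup>+ else acc_of M \<alpha>)}\<rparr>"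

lemma worlds_trans_closure_model [simp]: "worlds (trans_closure_model A M) = worlds M"
  and val_trans_closure_model [simp]: "val (trans_closure_model A M) = val M"
  and acc_of_trans_closure_model:
    "acc_of (trans_closure_model A M) \<alpha> = (if \<alpha> \<in> A then (acc_of M \<alpha>)\<^sup>+ else acc_of M \<alpha>)"
  by (auto simp: trans_closure_model_def acc_of_def)

lemma acc_of_subset: "kripke_model M \<Longrightarrow> acc_of M \<alpha> \<subseteq> worlds M \<times> worlds M"
  by (auto simp: kripke_model_def acc_of_def)

lemma kripke_model_trans_closure_model:
  assumes "kripke_model M"
  shows "kripke_model (trans_closure_model A M)"
proof -
  have "acc_of (trans_closure_model A M) \<alpha> \<subseteq> worlds M \<times> worlds M" for \<alpha>
    using acc_of_subset[OF assms] by (simp add: acc_of_trans_closure_model trancl_subset_Sigma)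
  moreover have "worlds M \<noteq> {}"
    using assms by (simp add: kripke_model_def)
  ultimately show ?thesis
    by (fastforce simp: kripke_model_def acc_of_def)
qed

lemma trans_closure_model_id:
  assumes "\<And>\<alpha>. \<alpha> \<in> A \<Longrightarrow> trans (acc_of M \<alpha>)"
  shows "trans_closure_model A M = M"
proof -
  have "{(u, \<alpha>, v). (u, v) \<in> (if \<alpha> \<in> A then (acc_of M \<alpha>)\<^sup>+ else acc_of M \<alpha>)} = acc M"
    using assms by (auto simp: acc_of_def trancl_id split: if_splits)
  then show ?thesis
    by (simp add: trans_closure_model_def)
qed

text \<open>\<open>D\<close> and \<open>T\<close> survive because the closure only adds edges,
  \<open>B\<close> because a path in a symmetric relation can be walked backwards, and
  \<open>4\<close> because every closure is transitive.\<close>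

lemma satisfies_cond_trancl:
  assumes "satisfies_cond W r c"
  shows "satisfies_cond W (r\<^sup>+) c"
  using assms by (cases c) (auto simp: refl_on_def sym_trancl intro: r_into_trancl')

text \<open>The diamond inside the fixed point forces at least one step, hence the closure is
  \<open>\<^sup>+\<close> and not the reflexive one. \<open>?E\<close> is shown to be the least
  prefixed point of the body.\<close>

lemma sem_Eve_Dia:
  assumes "kripke_model M"
  shows "sem M \<rho> (Eve \<alpha> (Dia \<alpha> \<psi>)) =
    {w \<in> worlds M. \<exists>v. (w, v) \<in> (acc_of M \<alpha>)\<^sup>+ \<and> v \<in> sem M \<rho> \<psi>}" (is "_ = ?E")
proof -
  let ?R = "acc_of M \<alpha>"
  define X where "X = fresh (Dia \<alpha> \<psi>)"
  have X: "X \<notin> fv \<psi>"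
    using fresh_notin_vars[of "Dia \<alpha> \<psi>"] fv_subset_vars[of \<psi>] by (auto simp: X_def)
  \<comment> \<open>By freshness, the body depends on \<open>S\<close> only through
    \<open>Var X\<close>.\<close>
  have sem_upd: "sem M (\<rho>(X := S)) \<psi> = sem M \<rho> \<psi>" for S
    by (rule sem_cong) (use X in auto)
  have R: "?R \<subseteq> worlds M \<times> worlds M"
    by (rule acc_of_subset[OF assms])
  let ?pre = "\<lambda>S. S \<subseteq> worlds M \<and> sem M (\<rho>(X := S)) (Or (Dia \<alpha> \<psi>) (Dia \<alpha> (Var X))) \<subseteq> S"
  have "?pre ?E"
    using R by (auto simp: sem_upd intro: trancl_into_trancl2)
  moreover have "?E \<subseteq> S" if S: "?pre S" for S
  proof
    fix w assume "w \<in> ?E"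
    then obtain v where "(w, v) \<in> ?R\<^sup>+" and v: "v \<in> sem M \<rho> \<psi>" by blast
    \<comment> \<open>Induction from the end of the path backwards: the last edge enters
      \<open>S\<close> through \<open>Dia \<alpha> \<psi>\<close>, each earlier one through
      \<open>Dia \<alpha> (Var X)\<close>.\<close>
    then show "w \<in> S"
      by (induction rule: converse_trancl_induct) (use S R v in \<open>auto simp: sem_upd\<close>)
  qed
  ultimately have "\<Inter>{S. ?pre S} = ?E" by blast
  then show ?thesis by (simp add: Eve_def Let_def X_def)
qed

text \<open>Dual to the case of \<open>Eve\<close>: \<open>?I\<close> is the greatest postfixed
  point of the body.\<close>

lemma sem_Inv_Box:
  assumes "kripke_model M"
  shows "sem M \<rho> (Inv \<alpha> (Box \<alpha> \<psi>)) =
    {w \<in> worlds M. \<forall>v. (w, v) \<in> (acc_of M \<alpha>)\<^sup>+ \<longrightarrow> v \<in> sem M \<rho> \<psi>}" (is "_ = ?I")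
proof -
  let ?R = "acc_of M \<alpha>"
  define X where "X = fresh (Box \<alpha> \<psi>)"
  have X: "X \<notin> fv \<psi>"
    using fresh_notin_vars[of "Box \<alpha> \<psi>"] fv_subset_vars[of \<psi>] by (auto simp: X_def)
  have sem_upd: "sem M (\<rho>(X := S)) \<psi> = sem M \<rho> \<psi>" for S
    by (rule sem_cong) (use X in auto)
  have R: "?R \<subseteq> worlds M \<times> worlds M"
    by (rule acc_of_subset[OF assms])
  let ?post = "\<lambda>S. S \<subseteq> worlds M \<and> S \<subseteq> sem M (\<rho>(X := S)) (And (Box \<alpha> \<psi>) (Box \<alpha> (Var X)))"
  have "?post ?I"
    using R by (auto simp: sem_upd intro: trancl_into_trancl2)
  moreover have "S \<subseteq> ?I" if S: "?post S" for S
  proof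
    fix w assume w: "w \<in> S"
    \<comment> \<open>Membership in \<open>S\<close> is carried along the path, since it is what
      allows the next edge to be taken.\<close>
    have "v \<in> S \<and> v \<in> sem M \<rho> \<psi>" if "(w, v) \<in> ?R\<^sup>+" for v
      using that by (induction rule: trancl_induct) (use S w in \<open>auto simp: sem_upd\<close>)
    then show "w \<in> ?I" using S w by blast
  qed
  ultimately have "\<Union>{S. ?post S} = ?I" by blast
  then show ?thesis by (simp add: Inv_def Let_def X_def)
qed

text \<open>The environment is generalised for the binders. There both sides range over the same
  sets \<open>S\<close>, as the closure keeps the worlds.\<close>

lemma sem_tr4:
  assumes "kripke_model M"
  shows "sem M \<rho> (tr4 A \<phi>) = sem (trans_closure_model A M) \<rho> \<phi>"
proof (induction \<phi> arbitrary: \<rho>)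
  case (Dia \<alpha> \<phi>)
  then show ?case
    by (cases "\<alpha> \<in> A") (simp_all add: sem_Eve_Dia[OF assms] acc_of_trans_closure_model)
next
  case (Box \<alpha> \<phi>)
  then show ?case
    by (cases "\<alpha> \<in> A") (simp_all add: sem_Inv_Box[OF assms] acc_of_trans_closure_model)
qed simp_all

theorem theorem3p18:
  fixes A :: "'ag::finite set"
    and L1 L2 :: "'ag modal_logic"
    and \<phi> :: "('ag, 'p::finite) fm"
  assumes "\<And>\<alpha>. \<alpha> \<in> A \<Longrightarrow> L1 \<alpha> = L2 \<alpha> \<union> {Cond4}"
    and "\<And>\<alpha>. \<alpha> \<notin> A \<Longrightarrow> L1 \<alpha> = L2 \<alpha>"
    and "\<And>\<alpha>. L2 \<alpha> \<subseteq> {CondD, CondT, CondB}"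
    and "closed_fm \<phi>"
  shows "satisfiable TYPE('w) L1 \<phi> \<longleftrightarrow> satisfiable TYPE('w) L2 (tr4 A \<phi>)"
proof
  assume "satisfiable TYPE('w) L1 \<phi>"
  then obtain M :: "('w, 'ag, 'p) kripke" and w
    where M: "L_model L1 M" and w: "w \<in> worlds M" "true_at M w \<phi>"
    by (auto simp: satisfiable_def)
  \<comment> \<open>\<open>L1\<close> asks for at least what \<open>L2\<close> asks for, so the
    given model can serve unchanged as the witness.\<close>
  have L1: "L2 \<alpha> \<subseteq> L1 \<alpha>" for \<alpha>
    using assms(1,2) by (cases "\<alpha> \<in> A") auto
  have "trans (acc_of M \<alpha>)" if "\<alpha> \<in> A" for \<alpha>
    using M assms(1)[OF that] by (force simp: L_model_def)
  then have "trans_closure_model A M = M"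
    by (rule trans_closure_model_id)
  then have "true_at M w (tr4 A \<phi>)"
    using M w by (simp add: true_at_def sem_tr4 L_model_def)
  moreover have "L_model L2 M"
    using M L1 by (auto simp: L_model_def)
  ultimately show "satisfiable TYPE('w) L2 (tr4 A \<phi>)"
    using w(1) by (auto simp: satisfiable_def)
next
  assume "satisfiable TYPE('w) L2 (tr4 A \<phi>)"
  then obtain M :: "('w, 'ag, 'p) kripke" and w
    where M: "L_model L2 M" and w: "w \<in> worlds M" "true_at M w (tr4 A \<phi>)"
    by (auto simp: satisfiable_def)
  let ?M = "trans_closure_model A M"
  have "true_at ?M w \<phi>"
    using M w by (simp add: true_at_def sem_tr4 L_model_def)
  \<comment> \<open>For an agent in \<open>A\<close>, either \<open>c\<close> is
    \<open>Cond4\<close>, which any closure satisfies, or \<open>c\<close> comes from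
    \<open>L2\<close> and passes to the closure. For the other agents the relation is the old
    one.\<close>
  moreover have "satisfies_cond (worlds ?M) (acc_of ?M \<alpha>) c" if "c \<in> L1 \<alpha>" for \<alpha> c
    using that M assms(1,2)[of \<alpha>]
    by (cases "\<alpha> \<in> A") (auto simp: acc_of_trans_closure_model L_model_def satisfies_cond_trancl)
  then have "L_model L1 ?M"
    using M by (simp add: L_model_def kripke_model_trans_closure_model)
  ultimately show "satisfiable TYPE('w) L1 \<phi>"
    using w(1) unfolding satisfiable_def by (metis worlds_trans_closure_model)
qed

end
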